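(* Let $\phi_{\mathrm{SD}}$ be the score-driven updating rule $\phi_{\mathrm{SD}}(y,\vartheta_{t|t-1})=\vartheta_{t|t-1}+A\mathcal{S}_{t-1}\,s(y,\vartheta_{t|t-1})$, where the $k\times k$ matrix $A\mathcal{S}_{t-1}$ is (symmetric) positive definite and known given $\mathcal{F}_{t-1}$. Let $\mathcal{P}$ be a class of true densities and assume: (1) $\Theta\subseteq\mathbb{R}^k$ is open and convex, $\vartheta_{t|t-1}\in\Theta$ and $\vartheta_{t|t}(Y_t)=\phi_{\mathrm{SD}}(Y_t,\vartheta_{t|t-1})\in\Theta$ (almost surely); (2) $\log f(x|\vartheta)$ is twice continuously differentiable in $\vartheta$ for all $\vartheta\in\Theta$ and $x\in\mathcal{Y}$; (3) $\mathbb{E}_{p_t}[s(X_t,\vartheta_{t|t-1})]$ and $\mathbb{E}_{p_t}[\|\Delta\phi_{\mathrm{SD}}(Y_t,\vartheta_{t|t-1})\|^2]$ are finite for all $\vartheta_{t|t-1}\in\Theta$ and $p_t\in\mathcal{P}$; (4) there exists a constant $c<\infty$ such that $\sup_{\vartheta\in\Theta}\|\mathbb{E}_{p_t}[H(X_t,\vartheta)]\|\le c$ for all $p_t\in\mathcal{P}$. Then, for any $\vartheta_{t|t-1}\in\Theta$ and $p_t\in\mathcal{P}$ with $\mathbb{E}_{p_t}[s(X_t,\vartheta_{t|t-1})]\neq 0$, there exists $\bar\kappa>0$ (with $\bar\kappa\le1$) such that $\Delta^{\mathsf{EKL}}(\phi_{\mathrm{SD},\kappa}|\vartheta_{t|t-1},p_t)<0$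 for all $\kappa\in(0,\bar\kappa]$, where $\phi_{\mathrm{SD},\kappa}(y,\vartheta_{t|t-1})=\vartheta_{t|t-1}+\kappa A\mathcal{S}_{t-1}\,s(y,\vartheta_{t|t-1})$.
   Context: Setting. Let $\mathcal{Y}\subseteq\mathbb{R}^l$ be the outcome space and fix a time $t$. Conditionally on the information set $\mathcal{F}_{t-1}$ at time $t-1$, the observation $Y_t$ has true density $p_t$ on $\mathcal{Y}$, belonging to a class $\mathcal{P}$ of absolutely continuous distributions (identified with their densities). Quantities known given $\mathcal{F}_{t-1}$, such as the predicted parameter $\vartheta_{t|t-1}\in\Theta$ and the static learning-rate matrix $A$ and scaling matrix $\mathcal{S}_{t-1}$, are treated as fixed. $\mathbb{E}_{p_t}$ denotes expectation under $p_t$, and $X_t$ denotes an independent copy of $Y_t$. The postulated (possibly misspecified) model is a family of densities $f(\cdot|\vartheta)$, $\vartheta\in\Theta\subseteq\mathbb{R}^k$; the support of $p_t$ is assumed to be contained in the support of $f(\cdot|\vartheta)$ for all $\vartheta\in\Theta$. The score is $s(y,\vartheta)=\frac{\partial}{\partial\vartheta}\log f(y|\vartheta)$ and the Hessian is $H(x,\vartheta)=\frac{\partial^2}{\partial\vartheta\,\partial\vartheta^\top}\log f(x|\vartheta)$. $\|\cdot\|$ is the Euclidean norm for vectors and the spectral norm for matrices. Updating rules. For an updating rule $\phi:\mathcal{Y}\times\Theta\to\Theta$, the updated parameter is $\vartheta_{t|t}(y)=\phi(y,\vartheta_{t|t-1})$ and $\Delta\phi(y,\vartheta_{t|t-1}):=\vartheta_{t|t}(y)-\vartheta_{t|t-1}$.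 Downscaling is considered for $0<\kappa\le1$. EKL. For an updating rule $\phi$ with $\vartheta_{t|t}(y)=\phi(y,\vartheta_{t|t-1})$, $$\mathsf{EKL}(p_t\Vert f_{t|t}):=\int_{\mathcal{Y}}\int_{\mathcal{Y}}\log\Big(\frac{p_t(x)}{f(x|\vartheta_{t|t}(y))}\Big)p_t(x)\,p_t(y)\,dx\,dy,$$ $$\mathsf{EKL}(p_t\Vert f_{t|t-1})=\int_{\mathcal{Y}}\log\Big(\frac{p_t(x)}{f(x|\vartheta_{t|t-1})}\Big)p_t(x)\,dx,$$ assumed finite throughout, and $\Delta^{\mathsf{EKL}}(\phi|\vartheta_{t|t-1},p_t):=\mathsf{EKL}(p_t\Vert f_{t|t})-\mathsf{EKL}(p_t\Vert f_{t|t-1})$.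
   Formalization: Adds the assumption that the Hessian H(x,·) is jointly integrable over outcomes (under p_t) and along each segment from the predicted parameter to any point of Θ; with only pointwise existence and boundedness of E[H] in (4) the claim is false. *)

theory Defs
  imports "HOL-Probability.Probability"
begin

text \<open>Densities are taken with respect to Lebesgue measure on the outcome space \<open>Y\<close>;
  only their values on \<open>Y\<close> matter.\<close>

definition law :: "(real^'l) set \<Rightarrow> (real^'l \<Rightarrow> real) \<Rightarrow> (real^'l) measure" where
  "law Y p = density (restrict_space lborel Y) (\<lambda>x. ennreal (p x))"

definition is_density :: "(real^'l) set \<Rightarrow> (real^'l \<Rightarrow> real) \<Rightarrow> bool" where
  "is_density Y p \<longleftrightarrow>
     p \<in> borel_measurable (restrict_space lborel Y) \<and> (\<forall>x\<in>Y. 0 \<le> p x) \<and> prob_space (law Y p)"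

text \<open>Parametric families \<open>f\<close> are curried: \<open>f x \<theta>\<close> is the density at outcome \<open>x\<close> under
  parameter \<open>\<theta>\<close>.\<close>

definition score :: "(real^'l \<Rightarrow> real^'k \<Rightarrow> real) \<Rightarrow> real^'l \<Rightarrow> real^'k \<Rightarrow> real^'k" where
  "score f x \<theta> = (\<chi> i. frechet_derivative (\<lambda>v. ln (f x v)) (at \<theta>) (axis i 1))"

definition hessian :: "(real^'l \<Rightarrow> real^'k \<Rightarrow> real) \<Rightarrow> real^'l \<Rightarrow> real^'k \<Rightarrow> real^'k^'k" where
  "hessian f x \<theta> = jacobian (score f x) (at \<theta>)"

text \<open>Twice continuous differentiability of \<open>\<theta> \<mapsto> ln (f x \<theta>)\<close> on an open set. Positivity is
  explicit because \<open>ln\<close> is total, with arbitrary values outside its proper domain.\<close>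

definition log_C2_on :: "(real^'k) set \<Rightarrow> (real^'l \<Rightarrow> real^'k \<Rightarrow> real) \<Rightarrow> real^'l \<Rightarrow> bool" where
  "log_C2_on \<Theta> f x \<longleftrightarrow>
     (\<forall>\<theta>\<in>\<Theta>. 0 < f x \<theta>) \<and>
     (\<forall>\<theta>\<in>\<Theta>. (\<lambda>v. ln (f x v)) differentiable (at \<theta>)) \<and>
     (\<forall>\<theta>\<in>\<Theta>. score f x differentiable (at \<theta>)) \<and>
     continuous_on \<Theta> (hessian f x)"

definition positive_definite :: "real^'k^'k \<Rightarrow> bool" where
  "positive_definite B \<longleftrightarrow> transpose B = B \<and> (\<forall>v. v \<noteq> 0 \<longrightarrow> 0 < v \<bullet> (B *v v))"

definition spectral_norm :: "real^'k^'k \<Rightarrow> real" where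
  "spectral_norm B = onorm ((*v) B)"

definition phi_SD ::
  "(real^'l \<Rightarrow> real^'k \<Rightarrow> real) \<Rightarrow> real^'k^'k \<Rightarrow> real^'k^'k \<Rightarrow> real^'l \<Rightarrow> real^'k \<Rightarrow> real^'k" where
  "phi_SD f A S y \<theta> = \<theta> + (A ** S) *v score f y \<theta>"

definition phi_SD_scaled ::
  "real \<Rightarrow> (real^'l \<Rightarrow> real^'k \<Rightarrow> real) \<Rightarrow> real^'k^'k \<Rightarrow> real^'k^'k \<Rightarrow> real^'l \<Rightarrow> real^'k \<Rightarrow> real^'k" where
  "phi_SD_scaled \<kappa> f A S y \<theta> = \<theta> + \<kappa> *\<^sub>R ((A ** S) *v score f y \<theta>)"

definition update_step :: "(real^'l \<Rightarrow> real^'k \<Rightarrow> real^'k) \<Rightarrow> real^'l \<Rightarrow> real^'k \<Rightarrow> real^'k" where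
  "update_step \<phi> y \<theta> = \<phi> y \<theta> - \<theta>"

definition EKL_pred ::
  "(real^'l) set \<Rightarrow> (real^'l \<Rightarrow> real^'k \<Rightarrow> real) \<Rightarrow> (real^'l \<Rightarrow> real) \<Rightarrow> real^'k \<Rightarrow> real" where
  "EKL_pred Y f p \<theta> = (LINT x|law Y p. ln (p x / f x \<theta>))"

definition EKL_upd ::
  "(real^'l) set \<Rightarrow> (real^'l \<Rightarrow> real^'k \<Rightarrow> real) \<Rightarrow> (real^'l \<Rightarrow> real) \<Rightarrow>
   (real^'l \<Rightarrow> real^'k \<Rightarrow> real^'k) \<Rightarrow> real^'k \<Rightarrow> real" where
  "EKL_upd Y f p \<phi> \<theta> = (LINT y|law Y p. LINT x|law Y p. ln (p x / f x (\<phi> y \<theta>)))"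

text \<open>The Bochner integral of a non-integrable function is 0, so finiteness of the divergences
  has to be expressed by integrability.\<close>

definition EKL_pred_finite ::
  "(real^'l) set \<Rightarrow> (real^'l \<Rightarrow> real^'k \<Rightarrow> real) \<Rightarrow> (real^'l \<Rightarrow> real) \<Rightarrow> real^'k \<Rightarrow> bool" where
  "EKL_pred_finite Y f p \<theta> \<longleftrightarrow> integrable (law Y p) (\<lambda>x. ln (p x / f x \<theta>))"

definition EKL_upd_finite ::
  "(real^'l) set \<Rightarrow> (real^'l \<Rightarrow> real^'k \<Rightarrow> real) \<Rightarrow> (real^'l \<Rightarrow> real) \<Rightarrow>
   (real^'l \<Rightarrow> real^'k \<Rightarrow> real^'k) \<Rightarrow> real^'k \<Rightarrow> bool" where
  "EKL_upd_finite Y f p \<phi> \<theta> \<longleftrightarrow>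
     (AE y in law Y p. integrable (law Y p) (\<lambda>x. ln (p x / f x (\<phi> y \<theta>)))) \<and>
     integrable (law Y p) (\<lambda>y. LINT x|law Y p. ln (p x / f x (\<phi> y \<theta>)))"

definition Delta_EKL ::
  "(real^'l) set \<Rightarrow> (real^'l \<Rightarrow> real^'k \<Rightarrow> real) \<Rightarrow> (real^'l \<Rightarrow> real^'k \<Rightarrow> real^'k) \<Rightarrow>
   real^'k \<Rightarrow> (real^'l \<Rightarrow> real) \<Rightarrow> real" where
  "Delta_EKL Y f \<phi> \<theta> p = EKL_upd Y f p \<phi> \<theta> - EKL_pred Y f p \<theta>"

text \<open>Absolute integrability of the Hessian over outcomes and the segment from \<open>\<theta>\<close> to \<open>\<theta>'\<close>
  jointly. This is what Fubini needs in order to take the expectation of the second-order Taylor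
  remainder of \<open>ln (f x \<theta>')\<close> around \<open>\<theta>\<close>; pointwise existence and boundedness of the expected
  Hessian do not suffice, since without it the gradient of \<open>\<theta> \<mapsto> E[ln (f X \<theta>)]\<close> can differ
  from the expected score.\<close>

definition hessian_segment_integrable ::
  "(real^'l) set \<Rightarrow> (real^'l \<Rightarrow> real^'k \<Rightarrow> real) \<Rightarrow> (real^'l \<Rightarrow> real) \<Rightarrow> real^'k \<Rightarrow> real^'k \<Rightarrow> bool" where
  "hessian_segment_integrable Y f p \<theta> \<theta>' \<longleftrightarrow>
     integrable (law Y p \<Otimes>\<^sub>M restrict_space lborel {0..1})
       (\<lambda>(x, u). hessian f x (\<theta> + u *\<^sub>R (\<theta>' - \<theta>)))"

end

theory Submission
  imports Defs
begin

text \<open>Write \<open>G \<theta>\<close> for the divergence \<open>E (ln (p X / f X \<theta>))\<close>, \<open>m\<close> for the expected score at the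
  predicted parameter \<open>\<theta>\<^sub>t\<close> and \<open>B = A S\<close>. The divergence after the update is \<open>E (G (\<theta>\<^sub>t + \<kappa> B s(Y)))\<close>,
  since \<open>X\<close> is independent of the observation \<open>Y\<close> that drives the step. The gradient of \<open>G\<close> at \<open>\<theta>\<^sub>t\<close> is
  \<open>- m\<close>, and the bounded expected Hessian controls the error of the first-order expansion, so for
  every \<open>\<theta>\<close> in the parameter set
  \<open>G \<theta> \<le> G \<theta>\<^sub>t - (\<theta> - \<theta>\<^sub>t) \<bullet> m + c / 2 * (norm (\<theta> - \<theta>\<^sub>t))\<^sup>2\<close>
  (\<open>EKL_pred_descent\<close>).
  Averaging this over the random step replaces \<open>s(Y)\<close> by \<open>m\<close> in the linear term, and the change in
  divergence is at most \<open>- \<kappa> * (m \<bullet> B m) + c / 2 * \<kappa>\<^sup>2 * E (norm (B s(Y)))\<^sup>2\<close>. An individual step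
  may point in a bad direction, but on average steps point along \<open>B m\<close>, where positive
  definiteness makes the first-order gain strict; the second-order loss is negligible for small
  \<open>\<kappa>\<close>.

  The descent inequality rests on \<open>log_density_taylor\<close>, a Taylor formula with integral remainder for
  each outcome, and on \<open>expected_remainder_bound\<close>, which exchanges the expectation with the
  integral along the segment and so uses a bound on the expected Hessian
  instead of one that is uniform in the outcome.\<close>

section \<open>Calculus along a segment\<close>

lemma gradient_score:
  fixes f :: "real^'l \<Rightarrow> real^'k \<Rightarrow> real"
  assumes "log_C2_on \<Theta> f x" "\<theta> \<in> \<Theta>"
  shows "((\<lambda>v. ln (f x v)) has_derivative (\<lambda>h. h \<bullet> score f x \<theta>)) (at \<theta>)"
proof -
  let ?D = "frechet_derivative (\<lambda>v. ln (f x v)) (at \<theta>)"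
  have D: "((\<lambda>v. ln (f x v)) has_derivative ?D) (at \<theta>)"
    using assms by (simp add: log_C2_on_def frechet_derivative_works)
  then have lin: "linear ?D"
    by (rule has_derivative_linear)
  have "?D h = h \<bullet> score f x \<theta>" for h
  proof -
    have "?D h = ?D (\<Sum>i\<in>UNIV. (h $ i) *\<^sub>R axis i 1)"
      by (simp add: basis_expansion flip: scalar_mult_eq_scaleR)
    also have "\<dots> = (\<Sum>i\<in>UNIV. h $ i * ?D (axis i 1))"
      by (simp add: linear_sum[OF lin] linear_cmul[OF lin])
    finally show ?thesis
      by (simp add: score_def inner_vec_def)
  qed
  then have "?D = (\<lambda>h. h \<bullet> score f x \<theta>)"
    by blast
  then show ?thesis
    using D by simp
qed

lemma derivative_score_hessian:
  fixes f :: "real^'l \<Rightarrow> real^'k \<Rightarrow> real"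
  assumes "log_C2_on \<Theta> f x" "\<theta> \<in> \<Theta>"
  shows "(score f x has_derivative (\<lambda>h. hessian f x \<theta> *v h)) (at \<theta>)"
  using assms jacobian_works by (force simp: log_C2_on_def hessian_def)

lemma bounded_linear_quadratic_form:
  fixes d :: "real^'k"
  shows "bounded_linear (\<lambda>M. d \<bullet> (M *v d))"
proof -
  have "linear (\<lambda>M::real^'k^'k. d \<bullet> (M *v d))"
    by (rule linearI)
      (simp_all add: matrix_vector_mult_add_rdistrib inner_add_right flip: scaleR_matrix_vector_assoc)
  then show ?thesis
    by (simp add: linear_conv_bounded_linear)
qed

lemma segment_in_convex:
  fixes \<theta> \<theta>' :: "'a::real_vector"
  assumes "convex \<Theta>" "\<theta> \<in> \<Theta>" "\<theta>' \<in> \<Theta>" "0 \<le> u" "u \<le> 1"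
  shows "\<theta> + u *\<^sub>R (\<theta>' - \<theta>) \<in> \<Theta>"
  using convexD_alt[OF assms(1-5)] by (simp add: algebra_simps)

text \<open>Differentiating \<open>\<lambda>u. (1 - u) * h' u + h u\<close>, with \<open>h\<close> the log-density along the segment,
  leaves just \<open>(1 - u) * h'' u\<close>. The remainder is kept in integral form, rather than as the second
  derivative at an intermediate point, because the intermediate point would depend on the outcome
  and expectations could then not be taken inside.\<close>

lemma log_density_taylor:
  fixes f :: "real^'l \<Rightarrow> real^'k \<Rightarrow> real"
  assumes C2: "log_C2_on \<Theta> f x" and cvx: "convex \<Theta>" and mem: "\<theta> \<in> \<Theta>" "\<theta>' \<in> \<Theta>"
  defines "d \<equiv> \<theta>' - \<theta>"
  shows "ln (f x \<theta>') - ln (f x \<theta>) = d \<bullet> score f x \<theta> +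
    (LINT u|restrict_space lborel {0..1}. (1 - u) * (d \<bullet> (hessian f x (\<theta> + u *\<^sub>R d) *v d)))"
proof -
  let ?g = "\<lambda>u. \<theta> + u *\<^sub>R d"
  let ?F = "\<lambda>u. (1 - u) * (d \<bullet> score f x (?g u)) + ln (f x (?g u))"
  let ?r = "\<lambda>u. (1 - u) * (d \<bullet> (hessian f x (?g u) *v d))"
  have seg: "?g u \<in> \<Theta>" if "0 \<le> u" "u \<le> 1" for u
    unfolding d_def using segment_in_convex[OF cvx mem that] .
  have g: "(?g has_derivative (\<lambda>h. h *\<^sub>R d)) (at u within {0..1})" for u
    by (auto intro!: derivative_eq_intros)
  have deriv: "(?F has_vector_derivative ?r u) (at u within {0..1})" if u: "0 \<le> u" "u \<le> 1" for u
  proof -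
    have s: "((\<lambda>u. score f x (?g u)) has_derivative (\<lambda>h. hessian f x (?g u) *v (h *\<^sub>R d)))
        (at u within {0..1})"
      using has_derivative_compose[OF g derivative_score_hessian[OF C2 seg[OF u]]] .
    have l: "((\<lambda>u. ln (f x (?g u))) has_derivative (\<lambda>h. (h *\<^sub>R d) \<bullet> score f x (?g u)))
        (at u within {0..1})"
      using has_derivative_compose[OF g gradient_score[OF C2 seg[OF u]]] .
    show ?thesis
      unfolding has_vector_derivative_def
      by (rule derivative_eq_intros s l refl)+ (auto simp: algebra_simps matrix_vector_mult_scaleR)
  qed
  have cont: "continuous_on {0..1} ?r"
  proof -
    have "continuous_on {0..1} (\<lambda>u. hessian f x (?g u))"
      by (rule continuous_on_compose2[of \<Theta> "hessian f x"])
        (use C2 seg in \<open>auto simp: log_C2_on_def intro!: continuous_intros\<close>)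
    then have "continuous_on {0..1} (\<lambda>u. d \<bullet> (hessian f x (?g u) *v d))"
      by (rule bounded_linear.continuous_on[OF bounded_linear_quadratic_form])
    then show ?thesis
      by (rule continuous_on_mult[OF continuous_on_diff[OF continuous_on_const continuous_on_id]])
  qed
  have "(LINT u|lborel. indicator {0..1} u *\<^sub>R ?r u) = ?F 1 - ?F 0"
    by (rule integral_FTC_Icc[OF _ deriv cont]) auto
  then show ?thesis
    by (simp add: integral_restrict_space d_def)
qed

section \<open>Expectations under the true density\<close>

lemma AE_law_space: "AE x in law Y p. x \<in> Y"
  by (rule AE_I2) (simp add: law_def space_restrict_space)

lemma AE_law_pos:
  assumes "is_density Y p"
  shows "AE x in law Y p. 0 < p x"
proof -
  have [measurable]: "p \<in> borel_measurable (restrict_space lborel Y)"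
    using assms by (simp add: is_density_def)
  show ?thesis
    unfolding law_def by (subst AE_density) auto
qed

text \<open>Fubini turns the expected Taylor remainder into an average of the expected Hessians along the
  segment, so that a bound on the expected Hessian suffices, whereas the Hessian itself may be
  unbounded in the outcome.\<close>

lemma expected_remainder_bound:
  fixes f :: "real^'l \<Rightarrow> real^'k \<Rightarrow> real"
  assumes prob: "prob_space (law Y p)"
    and cvx: "convex \<Theta>" and mem: "\<theta> \<in> \<Theta>" "\<theta>' \<in> \<Theta>"
    and hess_fin: "\<And>\<theta>. \<theta> \<in> \<Theta> \<Longrightarrow> integrable (law Y p) (\<lambda>x. hessian f x \<theta>)"
    and hess_bound: "\<And>\<theta>. \<theta> \<in> \<Theta> \<Longrightarrow> spectral_norm (LINT x|law Y p. hessian f x \<theta>) \<le> c"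
    and seg: "hessian_segment_integrable Y f p \<theta> \<theta>'"
  defines "d \<equiv> \<theta>' - \<theta>"
  defines "R \<equiv> \<lambda>x. LINT u|restrict_space lborel {0..1}.
      (1 - u) * (d \<bullet> (hessian f x (\<theta> + u *\<^sub>R d) *v d))"
  shows "integrable (law Y p) R"
    and "- (c / 2 * (norm d)\<^sup>2) \<le> (LINT x|law Y p. R x)"
proof -
  let ?M = "law Y p" and ?U = "restrict_space lborel {0..1::real}"
  let ?q = "\<lambda>H::real^'k^'k. d \<bullet> (H *v d)"
  let ?r = "\<lambda>x u. (1 - u) * ?q (hessian f x (\<theta> + u *\<^sub>R d))"
  note q = bounded_linear_quadratic_form[of d]
  interpret M: prob_space ?M
    by (rule prob)
  interpret U: finite_measure ?U
    by (rule finite_measureI) (simp add: emeasure_restrict_space space_restrict_space)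
  interpret P: pair_sigma_finite ?M ?U ..
  have "integrable (?M \<Otimes>\<^sub>M ?U) (\<lambda>z. hessian f (fst z) (\<theta> + snd z *\<^sub>R d))"
    using seg by (simp add: hessian_segment_integrable_def d_def case_prod_beta')
  then have int_q: "integrable (?M \<Otimes>\<^sub>M ?U) (\<lambda>z. ?q (hessian f (fst z) (\<theta> + snd z *\<^sub>R d)))"
    by (rule integrable_bounded_linear[OF q])
  have [measurable]: "(\<lambda>u. u) \<in> borel_measurable ?U"
    by (intro measurable_restrict_space1) simp
  have int_r: "integrable (?M \<Otimes>\<^sub>M ?U) (\<lambda>(x, u). ?r x u)"
  proof (rule Bochner_Integration.integrable_bound[OF int_q])
    show "(\<lambda>(x, u). ?r x u) \<in> borel_measurable (?M \<Otimes>\<^sub>M ?U)"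
      using borel_measurable_integrable[OF int_q] unfolding case_prod_beta'
      by measurable
    show "AE z in ?M \<Otimes>\<^sub>M ?U. norm (case z of (x, u) \<Rightarrow> ?r x u)
        \<le> norm (?q (hessian f (fst z) (\<theta> + snd z *\<^sub>R d)))"
      by (rule AE_I2)
        (auto simp: space_pair_measure space_restrict_space abs_mult intro!: mult_left_le_one_le)
  qed
  show "integrable ?M R"
    using P.integrable_fst'[OF int_r] by (simp add: R_def)
  have avg: "(LINT x|?M. R x) = (LINT u|?U. LINT x|?M. ?r x u)"
    unfolding R_def using P.Fubini_integral[OF int_r] by simp
  have int_u: "integrable ?U (\<lambda>u. LINT x|?M. ?r x u)"
    using P.integrable_snd[OF int_r] .
  let ?A = "\<lambda>u::real. u - u\<^sup>2 / 2"
  have FTC: "has_bochner_integral lborel (\<lambda>u. indicator {0..1} u *\<^sub>R (1 - u)) (?A 1 - ?A 0)"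
  proof (rule has_bochner_integral_FTC_Icc)
    show "(?A has_vector_derivative 1 - u) (at u within {0..1})" for u
      unfolding has_real_derivative_iff_has_vector_derivative[symmetric]
      by (auto intro!: derivative_eq_intros)
  qed (auto intro!: continuous_intros)
  have weight: "integrable ?U (\<lambda>u. 1 - u)" "(LINT u|?U. 1 - u) = 1 / 2"
    using FTC by (auto simp: integrable_restrict_space integral_restrict_space has_bochner_integral_iff)
  have int_c: "integrable ?U (\<lambda>u. - (c * (norm d)\<^sup>2) * (1 - u))"
    using weight(1) by (rule integrable_mult_right)
  have val_c: "(LINT u|?U. - (c * (norm d)\<^sup>2) * (1 - u)) = - (c / 2 * (norm d)\<^sup>2)"
    by (simp only: integral_mult_right_zero weight(2))
  have pw: "- (c * (norm d)\<^sup>2) * (1 - u) \<le> (LINT x|?M. ?r x u)" if "u \<in> space ?U" for u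
  proof -
    from that have u: "0 \<le> u" "u \<le> 1"
      by (auto simp: space_restrict_space)
    have "\<theta> + u *\<^sub>R d \<in> \<Theta>"
      unfolding d_def using segment_in_convex[OF cvx mem u] .
    note h = hess_fin[OF this] hess_bound[OF this]
    let ?EH = "LINT x|?M. hessian f x (\<theta> + u *\<^sub>R d)"
    have "\<bar>?q ?EH\<bar> \<le> norm d * norm (?EH *v d)"
      by (rule Cauchy_Schwarz_ineq2)
    also have "\<dots> \<le> norm d * (c * norm d)"
    proof (intro mult_left_mono)
      have "norm (?EH *v d) \<le> onorm ((*v) ?EH) * norm d"
        by (rule onorm) simp
      also have "\<dots> \<le> c * norm d"
        using h(2) by (intro mult_right_mono) (auto simp: spectral_norm_def)
      finally show "norm (?EH *v d) \<le> c * norm d" .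
    qed simp
    finally have "- (c * (norm d)\<^sup>2) \<le> ?q ?EH"
      by (simp add: power2_eq_square algebra_simps)
    then have "(- (c * (norm d)\<^sup>2)) * (1 - u) \<le> ?q ?EH * (1 - u)"
      using u by (intro mult_right_mono) auto
    also have "\<dots> = (LINT x|?M. ?r x u)"
      by (simp add: integral_bounded_linear[OF q h(1)])
    finally show ?thesis .
  qed
  show "- (c / 2 * (norm d)\<^sup>2) \<le> (LINT x|?M. R x)"
    unfolding avg val_c[symmetric] using int_c int_u pw by (rule integral_mono)
qed

text \<open>This is the descent lemma for the objective \<open>\<theta> \<mapsto> E (ln (p X / f X \<theta>))\<close>: its gradient
  at \<open>\<theta>\<close> is minus the expected score, and its second-order remainder is a weighted average over the segment
  of the quadratic form of minus the expected Hessian, whose norm is at most \<open>c\<close>.\<close>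

lemma EKL_pred_descent:
  fixes f :: "real^'l \<Rightarrow> real^'k \<Rightarrow> real"
  assumes dens: "is_density Y p" and model: "is_density Y (\<lambda>x. f x \<theta>')"
    and C2: "\<And>x. x \<in> Y \<Longrightarrow> log_C2_on \<Theta> f x"
    and cvx: "convex \<Theta>" and mem: "\<theta> \<in> \<Theta>" "\<theta>' \<in> \<Theta>"
    and fin: "EKL_pred_finite Y f p \<theta>"
    and score_fin: "integrable (law Y p) (\<lambda>x. score f x \<theta>)"
    and hess_fin: "\<And>\<theta>. \<theta> \<in> \<Theta> \<Longrightarrow> integrable (law Y p) (\<lambda>x. hessian f x \<theta>)"
    and hess_bound: "\<And>\<theta>. \<theta> \<in> \<Theta> \<Longrightarrow> spectral_norm (LINT x|law Y p. hessian f x \<theta>) \<le> c"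
    and seg: "hessian_segment_integrable Y f p \<theta> \<theta>'"
  shows "EKL_pred Y f p \<theta>' \<le> EKL_pred Y f p \<theta>
    - (\<theta>' - \<theta>) \<bullet> (LINT x|law Y p. score f x \<theta>) + c / 2 * (norm (\<theta>' - \<theta>))\<^sup>2"
proof -
  let ?M = "law Y p" and ?d = "\<theta>' - \<theta>"
  define R where "R = (\<lambda>x. LINT u|restrict_space lborel {0..1}.
      (1 - u) * (?d \<bullet> (hessian f x (\<theta> + u *\<^sub>R ?d) *v ?d)))"
  have prob: "prob_space ?M"
    using dens by (simp add: is_density_def)
  have R: "integrable ?M R" "- (c / 2 * (norm ?d)\<^sup>2) \<le> (LINT x|?M. R x)"
    unfolding R_def by (rule expected_remainder_bound[OF prob cvx mem hess_fin hess_bound seg]; assumption)+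
  let ?g = "\<lambda>x. ln (p x / f x \<theta>) - ?d \<bullet> score f x \<theta> - R x"
  \<comment> \<open>Where \<open>p x = 0\<close> the ratio is 0 and \<open>ln 0 = 0\<close>, so the logarithm splits only where \<open>p\<close> is positive.\<close>
  have ratio: "AE x in ?M. ln (p x / f x \<theta>') = ?g x"
    using AE_law_pos[OF dens] AE_law_space
  proof eventually_elim
    case (elim x)
    have "0 < f x \<theta>" "0 < f x \<theta>'"
      using C2[OF elim(2)] mem by (auto simp: log_C2_on_def)
    with elim log_density_taylor[OF C2[OF elim(2)] cvx mem] show ?case
      by (simp add: R_def ln_div)
  qed
  have int: "integrable ?M (\<lambda>x. ln (p x / f x \<theta>))"
    using fin by (simp add: EKL_pred_finite_def)
  have int_s: "integrable ?M (\<lambda>x. ?d \<bullet> score f x \<theta>)"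
    using score_fin by simp
  have "(\<lambda>x. ln (p x / f x \<theta>')) \<in> borel_measurable ?M"
    using dens model by (auto simp: is_density_def law_def)
  then have "EKL_pred Y f p \<theta>' = (LINT x|?M. ?g x)"
    unfolding EKL_pred_def using ratio int int_s R(1) by (intro integral_cong_AE) auto
  also have "\<dots> = EKL_pred Y f p \<theta> - ?d \<bullet> (LINT x|?M. score f x \<theta>) - (LINT x|?M. R x)"
    using int int_s R(1) score_fin by (simp add: EKL_pred_def)
  finally show ?thesis
    using R(2) by simp
qed

section \<open>Choosing the scale\<close>

theorem corollary1:
  fixes Y :: "(real^'l) set" and \<Theta> :: "(real^'k) set"
    and f :: "real^'l \<Rightarrow> real^'k \<Rightarrow> real"
    and P :: "(real^'l \<Rightarrow> real) set"
    and A S :: "real^'k^'k"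
    and p\<^sub>t :: "real^'l \<Rightarrow> real" and \<theta>\<^sub>t :: "real^'k"
  assumes Y: "Y \<in> sets borel"
    and model: "\<And>\<theta>. \<theta> \<in> \<Theta> \<Longrightarrow> is_density Y (\<lambda>x. f x \<theta>)"
    and truth: "\<And>p. p \<in> P \<Longrightarrow> is_density Y p"
    and pd: "positive_definite (A ** S)"
    and pt: "p\<^sub>t \<in> P"
    and EKL_pred: "EKL_pred_finite Y f p\<^sub>t \<theta>\<^sub>t"
    and EKL_upd: "\<And>\<kappa>. 0 < \<kappa> \<Longrightarrow> \<kappa> \<le> 1 \<Longrightarrow> EKL_upd_finite Y f p\<^sub>t (phi_SD_scaled \<kappa> f A S) \<theta>\<^sub>t"
    and Theta: "open \<Theta>" "convex \<Theta>"
    and pred: "\<theta>\<^sub>t \<in> \<Theta>"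
    and upd: "AE y in law Y p\<^sub>t. phi_SD f A S y \<theta>\<^sub>t \<in> \<Theta>"
    and C2: "\<And>x. x \<in> Y \<Longrightarrow> log_C2_on \<Theta> f x"
    and score_fin: "\<And>p \<theta>. p \<in> P \<Longrightarrow> \<theta> \<in> \<Theta> \<Longrightarrow> integrable (law Y p) (\<lambda>x. score f x \<theta>)"
    and step_fin: "\<And>p \<theta>. p \<in> P \<Longrightarrow> \<theta> \<in> \<Theta> \<Longrightarrow>
           integrable (law Y p) (\<lambda>y. (norm (update_step (phi_SD f A S) y \<theta>))\<^sup>2)"
    and hess_fin: "\<And>p \<theta>. p \<in> P \<Longrightarrow> \<theta> \<in> \<Theta> \<Longrightarrow> integrable (law Y p) (\<lambda>x. hessian f x \<theta>)"
    and hess_bound: "\<exists>c. \<forall>p\<in>P. \<forall>\<theta>\<in>\<Theta>. spectral_norm (LINT x|law Y p. hessian f x \<theta>) \<le> c"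
    and hess_seg: "\<And>\<theta>. \<theta> \<in> \<Theta> \<Longrightarrow> hessian_segment_integrable Y f p\<^sub>t \<theta>\<^sub>t \<theta>"
    and nonzero: "(LINT x|law Y p\<^sub>t. score f x \<theta>\<^sub>t) \<noteq> 0"
  shows "\<exists>\<kappa>bar. 0 < \<kappa>bar \<and> \<kappa>bar \<le> 1 \<and>
           (\<forall>\<kappa>. 0 < \<kappa> \<and> \<kappa> \<le> \<kappa>bar \<longrightarrow> Delta_EKL Y f (phi_SD_scaled \<kappa> f A S) \<theta>\<^sub>t p\<^sub>t < 0)"
proof -
  let ?M = "law Y p\<^sub>t" and ?B = "A ** S"
  let ?s = "\<lambda>y. score f y \<theta>\<^sub>t"
  let ?m = "LINT x|?M. ?s x"
  let ?V = "LINT y|?M. (norm (?B *v ?s y))\<^sup>2"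
  have dens: "is_density Y p\<^sub>t"
    using truth pt .
  interpret M: prob_space ?M
    using dens by (simp add: is_density_def)
  obtain c where c: "\<And>\<theta>. \<theta> \<in> \<Theta> \<Longrightarrow> spectral_norm (LINT x|?M. hessian f x \<theta>) \<le> c"
    using hess_bound pt by blast
  have int_s: "integrable ?M ?s"
    using score_fin pt pred .
  note B = matrix_vector_mul_bounded_linear[of ?B]
  have int_Bs: "integrable ?M (\<lambda>y. ?B *v ?s y)"
    using integrable_bounded_linear[OF B int_s] .
  have int_V: "integrable ?M (\<lambda>y. (norm (?B *v ?s y))\<^sup>2)"
    using step_fin[OF pt pred] by (simp add: update_step_def phi_SD_def)
  have gain: "0 < (?B *v ?m) \<bullet> ?m"
    using pd nonzero by (simp add: positive_definite_def inner_commute)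
  have decrease: "Delta_EKL Y f (phi_SD_scaled \<kappa> f A S) \<theta>\<^sub>t p\<^sub>t
      \<le> - \<kappa> * ((?B *v ?m) \<bullet> ?m) + c / 2 * \<kappa>\<^sup>2 * ?V" if \<kappa>: "0 < \<kappa>" "\<kappa> \<le> 1" for \<kappa>
  proof -
    let ?up = "\<lambda>y. phi_SD_scaled \<kappa> f A S y \<theta>\<^sub>t"
    let ?bd = "\<lambda>y. EKL_pred Y f p\<^sub>t \<theta>\<^sub>t - \<kappa> * ((?B *v ?s y) \<bullet> ?m)
      + c / 2 * \<kappa>\<^sup>2 * (norm (?B *v ?s y))\<^sup>2"
    have "EKL_upd Y f p\<^sub>t (phi_SD_scaled \<kappa> f A S) \<theta>\<^sub>t = (LINT y|?M. EKL_pred Y f p\<^sub>t (?up y))"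
      by (simp add: EKL_upd_def EKL_pred_def)
    also have "\<dots> \<le> (LINT y|?M. ?bd y)"
    proof (rule integral_mono_AE)
      show "integrable ?M (\<lambda>y. EKL_pred Y f p\<^sub>t (?up y))"
        using EKL_upd[OF \<kappa>] by (simp add: EKL_upd_finite_def EKL_pred_def)
      show "integrable ?M ?bd"
        using int_Bs int_V by simp
      show "AE y in ?M. EKL_pred Y f p\<^sub>t (?up y) \<le> ?bd y"
        using upd
      proof eventually_elim
        case (elim y)
        \<comment> \<open>The scaled update lies on the segment to the full update, hence in \<open>\<Theta>\<close>.\<close>
        have "?up y \<in> \<Theta>"
          using segment_in_convex[OF Theta(2) pred elim, of \<kappa>] \<kappa>
          by (simp add: phi_SD_def phi_SD_scaled_def)
        from EKL_pred_descent[OF dens model[OF this] C2 Theta(2) pred this EKL_pred int_s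
            hess_fin[OF pt] c hess_seg[OF this]]
        show ?case
          by (simp add: phi_SD_scaled_def power_mult_distrib algebra_simps)
      qed
    qed
    also have "\<dots> = EKL_pred Y f p\<^sub>t \<theta>\<^sub>t - \<kappa> * ((?B *v ?m) \<bullet> ?m) + c / 2 * \<kappa>\<^sup>2 * ?V"
      using int_Bs int_V by (simp add: M.prob_space integral_bounded_linear[OF B int_s])
    finally show ?thesis
      by (simp add: Delta_EKL_def)
  qed
  \<comment> \<open>\<open>C\<close> strictly exceeds the coefficient of \<open>\<kappa>\<^sup>2\<close> and is positive even if \<open>?V\<close> or \<open>c\<close> vanishes,
    so that dividing by it is harmless.\<close>
  define C where "C = \<bar>c\<bar> / 2 * ?V + 1"
  define \<kappa>bar where "\<kappa>bar = min 1 ((?B *v ?m) \<bullet> ?m / C)"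
  have V: "0 \<le> ?V"
    by simp
  then have C: "0 < C" "c / 2 * ?V < C"
    using mult_right_mono[OF abs_ge_self[of c] V] by (auto simp: C_def add_nonneg_pos)
  have "Delta_EKL Y f (phi_SD_scaled \<kappa> f A S) \<theta>\<^sub>t p\<^sub>t < 0" if \<kappa>: "0 < \<kappa>" "\<kappa> \<le> \<kappa>bar" for \<kappa>
  proof -
    have "\<kappa> * (c / 2 * ?V) < \<kappa> * C"
      using C(2) \<kappa>(1) by (rule mult_strict_left_mono)
    also have "\<dots> \<le> (?B *v ?m) \<bullet> ?m"
      using \<kappa>(2) C(1) by (simp add: \<kappa>bar_def pos_le_divide_eq)
    finally have "\<kappa> * (\<kappa> * (c / 2 * ?V)) < \<kappa> * ((?B *v ?m) \<bullet> ?m)"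
      using \<kappa>(1) by (rule mult_strict_left_mono)
    then have "- \<kappa> * ((?B *v ?m) \<bullet> ?m) + c / 2 * \<kappa>\<^sup>2 * ?V < 0"
      by (simp only: power2_eq_square) (simp add: mult_ac)
    moreover have "\<kappa> \<le> 1"
      using \<kappa>(2) by (simp add: \<kappa>bar_def)
    ultimately show ?thesis
      using decrease[OF \<kappa>(1)] by linarith
  qed
  moreover have "0 < \<kappa>bar" "\<kappa>bar \<le> 1"
    using gain C(1) by (auto simp: \<kappa>bar_def)
  ultimately show ?thesis
    by blast
qed

end
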